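(* Let $c\ge 2$ and $n\ge 1$ be integers. Write $n=cm+s$ with integers $m\ge 0$ and $s=n\bmod c\in\{0,\dots,c-1\}$, and set $r=s+1\in\{1,\dots,c\}$. Then the number of $c$-balanced Dyck paths of semilength $n$ is the Raney number $$R_{c+1,r}(m)=\frac{r}{(c+1)m+r}\binom{(c+1)m+r}{m}.$$
   Context: A Dyck path of semilength $n$ is a lattice path from $(0,0)$ to $(n,n)$ with unit east (E) steps $(1,0)$ and unit north (N) steps $(0,1)$ that never rises above the diagonal $y=x$. For $i\in\{1,\dots,n\}$, let $p_i$ be the number of cells in the $i$th column below the path $p$ (columns numbered $1,\dots,n$ from left to right), equivalently the number of N-steps taken before the $i$th E-step. Then $0=p_1\le p_2\le\cdots\le p_n$ and $p_i\le i-1$ for all $i$, and Dyck paths of semilength $n$ are in bijection with the integer vectors $(p_1,\dots,p_n)$ satisfying these conditions. Column $i$ is colored by its residue $i\bmod c$. The number of cells of color $j\in\mathbb{Z}/c\mathbb{Z}$ below $p$ is the class sum $S_j=\sum_{1\le i\le n,\ i\equiv j \pmod c} p_i$ (an empty sum is $0$). The path $p$ is called $c$-balanced if $S_0=S_1=\cdots=S_{c-1}$. *)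

theory Defs
  imports Complex_Main
begin

datatype step = East | North

(* After the first k steps the path is at (number of East steps, number of North steps)
   among them. The diagonal condition is imposed at these lattice points, which is the same
   as imposing it on the whole path. *)
definition dyck_path :: "nat \<Rightarrow> step list \<Rightarrow> bool" where
  "dyck_path n p \<longleftrightarrow>
     count_list p East = n \<and> count_list p North = n \<and>
     (\<forall>k \<le> length p. count_list (take k p) North \<le> count_list (take k p) East)"

(* The number p_i of North steps taken before the i-th East step, for 1 \<le> i \<le> n:
   the step at position k comes before the i-th East step or is that step itself iff fewer
   than i East steps precede position k. *)
definition column :: "step list \<Rightarrow> nat \<Rightarrow> nat" where
  "column p i = card {k. k < length p \<and> p ! k = North \<and> count_list (take k p) East < i}"

(* Residue classes modulo c are represented by j \<in> {0, ..., c - 1}. *)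
definition class_sum :: "nat \<Rightarrow> nat \<Rightarrow> step list \<Rightarrow> nat \<Rightarrow> nat" where
  "class_sum c n p j = (\<Sum>i \<in> {i \<in> {1..n}. i mod c = j}. column p i)"

definition balanced :: "nat \<Rightarrow> nat \<Rightarrow> step list \<Rightarrow> bool" where
  "balanced c n p \<longleftrightarrow> (\<forall>j < c. \<forall>j' < c. class_sum c n p j = class_sum c n p j')"

definition raney :: "nat \<Rightarrow> nat \<Rightarrow> nat \<Rightarrow> real" where
  "raney q r m = real r / real (q * m + r) * real ((q * m + r) choose m)"

end

(* Set p_0 = 0. If j is not congruent to n modulo c, then S_(j+1) - S_j is the sum of the
   nonnegative differences p_(i+1) - p_i over all i < n with i = j (mod c), because the shift
   i \<mapsto> i + 1 loses no term at the upper end. Hence a path is balanced iff every North step is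
   preceded by a number of East steps congruent to n, i.e. followed by a number of East steps
   divisible by c. Splitting off the first step of such a path gives the recursion of the
   weighted ballot numbers (y + 1 - c a) / (y + 1) * binomial (a + y) a, where x and y are the
   numbers of remaining East and North steps and a = x div c. *)
theory Submission
  imports Defs
begin

section \<open>Class sums and the abscissas of North steps\<close>

lemma count_list_take_drop:
  "count_list (take k p) x + count_list (drop k p) x = count_list p x"
  by (metis append_take_drop_id count_list_append)

definition norths :: "step list \<Rightarrow> nat \<Rightarrow> nat" where
  "norths p i = card {k. k < length p \<and> p ! k = North \<and> count_list (take k p) East = i}"

lemma column_0: "column p 0 = 0"
  by (simp add: column_def)

lemma column_Suc: "column p (Suc i) = column p i + norths p i"
proof -
  have "{k. k < length p \<and> p ! k = North \<and> count_list (take k p) East < Suc i} =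
      {k. k < length p \<and> p ! k = North \<and> count_list (take k p) East < i} \<union>
      {k. k < length p \<and> p ! k = North \<and> count_list (take k p) East = i}"
    by auto
  then show ?thesis
    unfolding column_def norths_def by (simp add: card_Un_disjoint disjoint_iff)
qed

lemma norths_eq_0_iff:
  "norths p i = 0 \<longleftrightarrow>
    (\<forall>k < length p. p ! k = North \<longrightarrow> count_list (take k p) East \<noteq> i)"
  unfolding norths_def by auto

lemma class_sum_Suc:
  assumes "j < c" "j \<noteq> n mod c"
  shows "class_sum c n p (Suc j mod c) =
    class_sum c n p j + (\<Sum>i \<in> {i \<in> {..<n}. i mod c = j}. norths p i)"
proof -
  have img: "{i \<in> {1..n}. i mod c = Suc j mod c} = Suc ` {i \<in> {..<n}. i mod c = j}"
  proof -
    have *: "Suc i mod c = Suc j mod c \<longleftrightarrow> i mod c = j" for i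
      using assms(1) by (metis mod_Suc mod_less nat.inject nat.simps(3))
    show ?thesis
    proof (intro set_eqI iffI)
      fix i assume "i \<in> {i \<in> {1..n}. i mod c = Suc j mod c}"
      then show "i \<in> Suc ` {i \<in> {..<n}. i mod c = j}"
        using * by (cases i) auto
    qed (use * in auto)
  qed
  have "class_sum c n p (Suc j mod c) = (\<Sum>i \<in> {i \<in> {..<n}. i mod c = j}. column p (Suc i))"
    unfolding class_sum_def img by (simp add: sum.reindex)
  moreover have "class_sum c n p j = (\<Sum>i \<in> {i \<in> {..<n}. i mod c = j}. column p i)"
    unfolding class_sum_def
  \<comment> \<open>The index sets can differ only in 0 and n: \<open>column p 0\<close> vanishes,
    and the residue of n is excluded.\<close>
  proof (rule sum.mono_neutral_cong)
    show "column p i = 0" if "i \<in> {i \<in> {..<n}. i mod c = j} - {i \<in> {1..n}. i mod c = j}" for i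
      using that by (cases i) (auto simp: column_0)
    show "column p i = 0" if "i \<in> {i \<in> {1..n}. i mod c = j} - {i \<in> {..<n}. i mod c = j}" for i
      using that assms(2) by (cases "i = n") auto
  qed auto
  ultimately show ?thesis
    by (simp add: column_Suc sum.distrib)
qed

text \<open>Equality of cyclically consecutive class sums makes a sum of natural numbers vanish,
  hence each term. Conversely, the one link not controlled, from \<open>n mod c\<close> to its
  successor, is bypassed by going round the cycle the other way.\<close>

lemma balanced_iff_norths:
  assumes "c > 0"
  shows "balanced c n p \<longleftrightarrow> (\<forall>i < n. i mod c \<noteq> n mod c \<longrightarrow> norths p i = 0)"
proof
  assume bal: "balanced c n p"
  show "\<forall>i < n. i mod c \<noteq> n mod c \<longrightarrow> norths p i = 0"
  proof (intro allI impI)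
    fix i assume i: "i < n" "i mod c \<noteq> n mod c"
    have "i mod c < c"
      using assms by simp
    then have "class_sum c n p (Suc (i mod c) mod c) = class_sum c n p (i mod c)"
      using bal assms unfolding balanced_def by (metis mod_less_divisor)
    then have "(\<Sum>i' \<in> {i' \<in> {..<n}. i' mod c = i mod c}. norths p i') = 0"
      using class_sum_Suc[OF \<open>i mod c < c\<close> i(2), of p] by linarith
    then show "norths p i = 0"
      using i(1) by simp
  qed
next
  assume zero: "\<forall>i < n. i mod c \<noteq> n mod c \<longrightarrow> norths p i = 0"
  have step: "class_sum c n p (Suc j mod c) = class_sum c n p j" if "j < c" "j \<noteq> n mod c" for j
    using class_sum_Suc[OF that] that zero by auto
  \<comment> \<open>The walk starts just after the residue of n and reaches it again only at
    \<open>t = c - 1\<close>, so it never crosses the uncontrolled link.\<close>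
  have cyc: "class_sum c n p ((n + Suc t) mod c) = class_sum c n p (Suc n mod c)" if "t < c" for t
    using that
  proof (induction t)
    case (Suc t)
    have "(n + Suc t) mod c \<noteq> n mod c"
    proof
      assume "(n + Suc t) mod c = n mod c"
      then have "c dvd Suc t"
        using mod_eq_dvd_iff_nat[of n "n + Suc t" c] by simp
      then show False
        using Suc.prems by (auto dest: dvd_imp_le)
    qed
    then have "class_sum c n p (Suc ((n + Suc t) mod c) mod c) = class_sum c n p ((n + Suc t) mod c)"
      using assms by (intro step) auto
    then show ?case
      using Suc by (simp add: mod_Suc_eq)
  qed simp
  have "class_sum c n p j = class_sum c n p (Suc n mod c)" if "j < c" for j
  proof -
    \<comment> \<open>This is the residue of j - (n + 1); the added multiple of c keeps the
      subtraction from truncating.\<close>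
    define t where "t = (j + c * Suc n - Suc n) mod c"
    have "(n + Suc t) mod c = (Suc n + (j + c * Suc n - Suc n)) mod c"
      unfolding t_def by (metis add_Suc_right add_Suc mod_add_right_eq)
    also have "Suc n + (j + c * Suc n - Suc n) = j + c * Suc n"
      using assms by (cases c) auto
    also have "\<dots> mod c = j"
      using that by (simp del: mult_Suc_right)
    finally show ?thesis
      using cyc[of t] assms by (simp add: t_def)
  qed
  then show "balanced c n p"
    unfolding balanced_def by metis
qed

section \<open>The conditions in terms of the remaining steps\<close>

definition suffix_ballot :: "nat \<Rightarrow> step list \<Rightarrow> bool" where
  "suffix_ballot c p \<longleftrightarrow>
    (\<forall>k \<le> length p. count_list (drop k p) East \<le> count_list (drop k p) North) \<and>
    (\<forall>k < length p. p ! k = North \<longrightarrow> c dvd count_list (drop k p) East)"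

lemma suffix_ballot_Nil: "suffix_ballot c []"
  by (simp add: suffix_ballot_def)

text \<open>Suffix conditions do not mention n, so a tail inherits them; only the position k = 0
  adds something new. This is what makes a recursion on the first step possible.\<close>

lemma suffix_ballot_Cons:
  "suffix_ballot c (a # p) \<longleftrightarrow> suffix_ballot c p \<and>
    count_list (a # p) East \<le> count_list (a # p) North \<and>
    (a = North \<longrightarrow> c dvd count_list p East)"
  unfolding suffix_ballot_def less_Suc_eq_le[symmetric] length_Cons All_less_Suc2
  by auto

lemma suffix_ballot_le:
  "suffix_ballot c p \<Longrightarrow> count_list p East \<le> count_list p North"
  unfolding suffix_ballot_def by force

text \<open>Prefix and suffix counts add up to n for both kinds of step. Complementing reverses the
  diagonal inequality and turns congruence to n into divisibility by c.\<close>

lemma dyck_balanced_iff: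
  assumes "c > 0"
  shows "dyck_path n p \<and> balanced c n p \<longleftrightarrow>
    count_list p East = n \<and> count_list p North = n \<and> suffix_ballot c p"
proof (cases "count_list p East = n \<and> count_list p North = n")
  case True
  have E: "count_list (take k p) East + count_list (drop k p) East = n"
    and N: "count_list (take k p) North + count_list (drop k p) North = n" for k
    using True count_list_take_drop by metis+
  have le: "count_list (take k p) North \<le> count_list (take k p) East \<longleftrightarrow>
      count_list (drop k p) East \<le> count_list (drop k p) North" for k
    using E[of k] N[of k] by linarith
  have mod: "count_list (take k p) East mod c = n mod c \<longleftrightarrow> c dvd count_list (drop k p) East" for k
    using E[of k] mod_eq_dvd_iff_nat[of "count_list (take k p) East" n c] by fastforce
  have "balanced c n p \<longleftrightarrow>
      (\<forall>k < length p. p ! k = North \<longrightarrow> count_list (take k p) East mod c = n mod c)"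
    unfolding balanced_iff_norths[OF assms] norths_eq_0_iff
  proof (intro iffI allI impI)
    fix k
    assume *: "\<forall>i<n. i mod c \<noteq> n mod c \<longrightarrow>
        (\<forall>k<length p. p ! k = North \<longrightarrow> count_list (take k p) East \<noteq> i)"
      and k: "k < length p" "p ! k = North"
    show "count_list (take k p) East mod c = n mod c"
      \<comment> \<open>A North step not covered by \<open>i < n\<close> has all n East steps before
        it, and its residue is trivially right.\<close>
      using * k E[of k] by (cases "count_list (take k p) East < n") auto
  qed auto
  then show ?thesis
    unfolding dyck_path_def suffix_ballot_def using True le mod by simp
qed (auto simp: dyck_path_def)

section \<open>Counting by the first step\<close>

definition ballot_paths :: "nat \<Rightarrow> nat \<Rightarrow> nat \<Rightarrow> step list set" where
  "ballot_paths c x y =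
    {p. count_list p East = x \<and> count_list p North = y \<and> suffix_ballot c p}"

lemma finite_ballot_paths: "finite (ballot_paths c x y)"
proof (rule finite_subset)
  have "length p = count_list p East + count_list p North" for p
  proof (induction p)
    case (Cons a p)
    then show ?case by (cases a) auto
  qed simp
  then show "ballot_paths c x y \<subseteq> {p. set p \<subseteq> {East, North} \<and> length p = x + y}"
    unfolding ballot_paths_def using step.exhaust by auto
qed (simp add: finite_lists_length_eq)

lemma ballot_paths_0_0: "ballot_paths c 0 0 = {[]}"
proof -
  have "p = []" if "count_list p East = 0" "count_list p North = 0" for p
  proof (cases p)
    case (Cons a q)
    then show ?thesis using that by (cases a) auto
  qed
  then show ?thesis
    unfolding ballot_paths_def by (auto simp: suffix_ballot_Nil)
qed

lemma ballot_paths_empty: "y < x \<Longrightarrow> ballot_paths c x y = {}"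
  unfolding ballot_paths_def using suffix_ballot_le by fastforce

text \<open>Here \<open>x \<le> y\<close> is the inequality at the whole word, and
  \<open>0 < y\<close> excludes the empty word and makes \<open>y - 1\<close> a true
  predecessor.\<close>

lemma ballot_paths_rec:
  assumes "x \<le> y" "0 < y"
  shows "ballot_paths c x y =
    (if x = 0 then {} else (#) East ` ballot_paths c (x - 1) y) \<union>
    (if c dvd x then (#) North ` ballot_paths c x (y - 1) else {})" (is "_ = ?R")
proof (intro set_eqI iffI)
  fix p assume p: "p \<in> ballot_paths c x y"
  then obtain a q where "p = a # q"
    using assms unfolding ballot_paths_def by (cases p) auto
  then show "p \<in> ?R"
    using p unfolding ballot_paths_def by (cases a) (auto simp: suffix_ballot_Cons)
next
  fix p assume "p \<in> ?R"
  then show "p \<in> ballot_paths c x y"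
    using assms unfolding ballot_paths_def
    by (auto simp: suffix_ballot_Cons split: if_splits)
qed

lemma card_ballot_paths_rec:
  assumes "x \<le> y" "0 < y"
  shows "card (ballot_paths c x y) =
    (if x = 0 then 0 else card (ballot_paths c (x - 1) y)) +
    (if c dvd x then card (ballot_paths c x (y - 1)) else 0)"
  unfolding ballot_paths_rec[OF assms]
  by (subst card_Un_disjoint) (auto simp: finite_ballot_paths card_image)

lemma choose_Suc_absorb: "Suc k * (k + n choose Suc k) = n * (k + n choose k)"
  using binomial_absorb_comp[of "k + n" k] binomial_absorption[of k "k + n"] by simp

lemma card_ballot_paths:
  assumes "c > 0" "x \<le> y"
  shows "(real y + 1) * real (card (ballot_paths c x y)) =
    (real y + 1 - real c * real (x div c)) * real (x div c + y choose (x div c))"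
  using assms(2)
proof (induction "x + y" arbitrary: x y rule: less_induct)
  case less
  \<comment> \<open>The first step is forced to be North if x = 0, and East if c does not divide x,
    which leaves \<open>x div c\<close> unchanged. Only the last case has two branches.\<close>
  consider "y = 0" | "y > 0" "x = 0" | "y > 0" "x > 0" "\<not> c dvd x" | "x > 0" "c dvd x"
    by blast
  then show ?case
  proof cases
    case 1
    then show ?thesis using less.prems by (simp add: ballot_paths_0_0)
  next
    case 2
    then have "card (ballot_paths c x y) = card (ballot_paths c 0 (y - 1))"
      by (simp add: card_ballot_paths_rec)
    moreover have "card (ballot_paths c 0 (y - 1)) = 1"
      using less.hyps[of 0 "y - 1"] 2 by (simp add: of_nat_diff)
    ultimately show ?thesis using 2 by simp
  next
    case 3
    then have "card (ballot_paths c x y) = card (ballot_paths c (x - 1) y)"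
      using less.prems by (simp add: card_ballot_paths_rec)
    moreover have "x div c = (x - 1) div c"
      using 3 div_Suc[of "x - 1" c] by (auto simp: dvd_eq_mod_eq_0)
    ultimately show ?thesis
      using less.hyps[of "x - 1" y] less.prems 3 by simp
  next
    case 4
    then obtain b where x: "x = c * Suc b"
      by (metis dvdE gr0_conv_Suc nat_0_less_mult_iff)
    have div: "x div c = Suc b" "(x - 1) div c = b"
      using assms(1) unfolding x by (auto intro!: div_nat_eqI simp: algebra_simps)
    let ?h1 = "real (card (ballot_paths c (x - 1) y))"
    let ?h2 = "real (card (ballot_paths c x (y - 1)))"
    \<comment> \<open>\<open>P\<close> and \<open>Q\<close> are the binomials for an East and a
      North first step; by Pascal's rule they add up to the one for (x, y).\<close>
    define P where "P = real (b + y choose b)"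
    define Q where "Q = real (b + y choose Suc b)"
    have sum: "real (Suc b + y choose Suc b) = P + Q"
      by (simp add: P_def Q_def)
    have PQ: "(real b + 1) * Q = real y * P"
      unfolding P_def Q_def using choose_Suc_absorb[of b y]
      by (metis Suc_eq_plus1 of_nat_Suc of_nat_mult add.commute)
    have h1: "(real y + 1) * ?h1 = (real y + 1 - real c * real b) * P"
      using less.hyps[of "x - 1" y] less.prems 4 div by (simp add: P_def)
    \<comment> \<open>For \<open>x = y\<close> both sides vanish: the closed form is zero on the line just outside the
      admissible region.\<close>
    have h2: "real y * ?h2 = (real y - real c * (real b + 1)) * Q"
    proof (cases "x = y")
      case True
      then have "real y = real c * (real b + 1)"
        using x by (metis of_nat_Suc of_nat_mult add.commute)
      then show ?thesis
        using True 4 by (simp add: ballot_paths_empty)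
    next
      case False
      then have "x \<le> y - 1" "Suc b + (y - 1) = b + y"
        using less.prems by auto
      then show ?thesis
        using less.hyps[of x "y - 1"] 4 less.prems by (simp add: div Q_def of_nat_diff algebra_simps)
    qed
    \<comment> \<open>The factor y makes \<open>h2\<close> applicable. The deviation from the closed
      form is then c times the difference of the two sides of \<open>PQ\<close>, hence zero.\<close>
    have "real y * ((real y + 1) * (?h1 + ?h2)) =
        real y * ((real y + 1 - real c * real b) * P) +
        (real y + 1) * ((real y - real c * (real b + 1)) * Q)"
      unfolding h1[symmetric] h2[symmetric] by (simp add: algebra_simps)
    also have "\<dots> = real y * ((real y + 1 - real c * (real b + 1)) * (P + Q)) +
        real c * (real y * P - (real b + 1) * Q)"
      by (simp add: algebra_simps)
    also have "\<dots> = real y * ((real y + 1 - real c * (real b + 1)) * (P + Q))"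
      using PQ by simp
    finally have "(real y + 1) * (?h1 + ?h2) = (real y + 1 - real c * (real b + 1)) * (P + Q)"
      using 4 less.prems by simp
    then show ?thesis
      using 4 less.prems sum by (simp add: card_ballot_paths_rec div add.commute)
  qed
qed

theorem theorem1p3:
  fixes c n m s r :: nat
  assumes "c \<ge> 2" and "n \<ge> 1"
    and "n = c * m + s" and "s = n mod c" and "r = s + 1"
  shows "real (card {p. dyck_path n p \<and> balanced c n p}) = raney (c + 1) r m"
proof -
  have "s < c"
    using assms(1,4) by simp
  then have "n div c = m"
    using assms(3) by simp
  moreover have "real n + 1 - real c * real m = real r"
    using assms(3,5) by simp
  \<comment> \<open>At x = y = n the linear factor n + 1 - c m is s + 1 = r.\<close>
  ultimately have card: "(real n + 1) * real (card (ballot_paths c n n)) = real r * real (m + n choose m)"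
    using card_ballot_paths[of c n n] assms(1) by simp
  \<comment> \<open>Absorption trades the denominator n + 1 for m + n + 1, which is the upper index
    (c + 1) m + r of the Raney number.\<close>
  have "Suc (m + n) * (m + n choose m) = (n + 1) * (Suc (m + n) choose m)"
    using binomial_absorb_comp[of "Suc (m + n)" m] by (simp add: Suc_diff_le)
  then have "real (Suc (m + n)) * real (m + n choose m) = (real n + 1) * real (Suc (m + n) choose m)"
    by (metis of_nat_Suc of_nat_mult Suc_eq_plus1 add.commute)
  moreover have "(c + 1) * m + r = Suc (m + n)"
    using assms(3,5) by simp
  ultimately have "(real n + 1) * raney (c + 1) r m = real r * real (m + n choose m)"
    unfolding raney_def by (simp add: field_simps del: of_nat_Suc binomial_Suc_Suc)
  with card have "(real n + 1) * real (card (ballot_paths c n n)) = (real n + 1) * raney (c + 1) r m"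
    by simp
  moreover have "{p. dyck_path n p \<and> balanced c n p} = ballot_paths c n n"
    unfolding ballot_paths_def using dyck_balanced_iff[of c n] assms(1) by auto
  ultimately show ?thesis
    by (simp add: add_nonneg_eq_0_iff)
qed

end
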